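(* Let $N_H\in\mathbb{N}$ with $N_H\ge 3$. Let $C_0,\dots,C_{N_H-1},E,\Phi$ be functions of time, continuously differentiable in $t$, with values in the discontinuous piecewise polynomial space $V_h^k$, such that for all $t$, all cells $I_j$, and all test functions $\phi_n,\eta,\zeta\in V_h^k$: (i) for every $n\in\{0,\dots,N_H-1\}$, $$\frac{d}{dt}\int_{I_j}C_n\,\phi_n\,dx+a_n^j(g_n,\phi_n)-\frac{\sqrt n}{v_{th}}\int_{I_j}E\,C_{n-1}\,\phi_n\,dx=\langle r_n^j,\phi_n\rangle,$$ where $\langle r_n^j,\phi_n\rangle=0$ for $n\notin\{1,2\}$ and $$\langle r_1^j,\phi_1\rangle=-\frac{\beta}{2v_{th}^2}\left([\Phi]_{j-\frac12}[E]_{j-\frac12}\,\phi^+_{1,j-\frac12}+[\Phi]_{j+\frac12}[E]_{j+\frac12}\,\phi^-_{1,j+\frac12}\right),$$ $$\langle r_2^j,\phi_2\rangle=\frac{1}{\sqrt2\,v_{th}}\left(\left(\{C_1\}-\hat C_1\right)_{j-\frac12}[\Phi]_{j-\frac12}\,\phi^+_{2,j-\frac12}+\left(\{C_1\}-\hat C_1\right)_{j+\frac12}[\Phi]_{j+\frac12}\,\phi^-_{2,j+\frac12}\right);$$ (ii) $(E,\Phi)$ satisfies the discrete Poisson problem $$\int_{I_j}\Phi\,\eta'\,dx-\hat\Phi_{j+\frac12}\eta^-_{j+\frac12}+\hat\Phi_{j-\frac12}\eta^+_{j-\frac12}=\int_{I_j}E\,\eta\,dx,$$ $$-\int_{I_j}E\,\zeta'\,dx+\hat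 E_{j+\frac12}\zeta^-_{j+\frac12}-\hat E_{j-\frac12}\zeta^+_{j-\frac12}=\int_{I_j}(v_{th}C_0-\rho_0)\,\zeta\,dx,$$ with fluxes $\hat\Phi=\{\Phi\}$ and $\hat E=\{E\}-\beta[\Phi]$ at every interface. Then discrete mass and momentum are conserved, $$v_{th}^{\ell+1}\,\frac{d}{dt}\int_0^L C_\ell\,dx=0,\qquad \ell=0,1,$$ and the discrete total energy $$\mathcal{E}_h(t):=\frac12\int_0^L\left[v_{th}^3\left(\sqrt2\,C_2+C_0\right)+|E|^2\right]dx+\frac12\,\beta\sum_{j}[\Phi]^2_{j-\frac12}$$ is constant in time.
   Context: Fix $L>0$, $v_{th}>0$, $\rho_0\in\mathbb{R}$, $\beta>0$ (a constant independent of $t$; it may depend on the mesh size $h$, e.g. a constant times $1/h$), and an integer $k\ge0$. The interval $\Omega=[0,L]$ is partitioned by $0=x_{\frac12}<x_{\frac32}<\dots<x_{N_x+\frac12}=L$ into cells $I_j=[x_{j-\frac12},x_{j+\frac12}]$, $j=1,\dots,N_x$; periodic boundary conditions identify $x_{\frac12}$ and $x_{N_x+\frac12}$ (so at the interface $x_{\frac12}\equiv x_{N_x+\frac12}$ the left trace is taken from $I_{N_x}$ and the right trace from $I_1$). Set $V_h^k=\{u\in L^2(\Omega): u|_{I_j}\text{ is a polynomial of degree at most }k,\ \forall j\}$. For $u\in V_h^k$, $u^\pm_{j+\frac12}$ are the right ($+$) and left ($-$) limits at $x_{j+\frac12}$, $[u]_{j+\frac12}=u^+_{j+\frac12}-u^-_{j+\frac12}$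 is the jump and $\{u\}_{j+\frac12}=\frac12(u^+_{j+\frac12}+u^-_{j+\frac12})$ the average. Sums over $j$ run over $j=1,\dots,N_x$. Derivatives $\phi'$ are taken cellwise. Conventions: $C_{-1}=0$, $C_{N_H}=0$. Define $g_n=v_{th}\left(\sqrt{n+1}\,C_{n+1}+\sqrt n\,C_{n-1}\right)$ and $$a_n^j(g_n,\phi)=-\int_{I_j}g_n\,\phi'\,dx+\hat g_{n,j+\frac12}\,\phi^-_{j+\frac12}-\hat g_{n,j-\frac12}\,\phi^+_{j-\frac12},$$ with the global Lax–Friedrichs flux at each interface $\hat g_n=\frac12\left[g_n^-+g_n^+-\alpha\,(C_n^+-C_n^-)\right]$, $\alpha=v_{th}\sqrt{N_H}$. The quantity $\hat C_1$ is the flux of the equation for $C_0$ divided by $v_{th}$: $\hat C_1=\hat g_0/v_{th}$. *)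

theory Defs
  imports "HOL-Analysis.Analysis" "HOL-Computational_Algebra.Polynomial"
begin

section \<open>Mesh, periodic traces and the discontinuous polynomial space\<close>

text \<open>Nodes are indexed by \<open>i = 0, \<dots>, Nx\<close>, and \<open>xi i\<close> is the point $x_{i+1/2}$. Hence the interface
  $x_{j+1/2}$ is node \<open>j\<close>, the interface $x_{j-1/2}$ is node \<open>j - 1\<close>, and $I_j$ is
  \<open>cell xi j\<close> for \<open>j = 1, \<dots>, Nx\<close>.\<close>

definition mesh :: "real \<Rightarrow> nat \<Rightarrow> (nat \<Rightarrow> real) \<Rightarrow> bool" where
  "mesh L Nx xi \<longleftrightarrow> Nx \<ge> 1 \<and> xi 0 = 0 \<and> xi Nx = L \<and> (\<forall>i<Nx. xi i < xi (Suc i))"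

definition cell :: "(nat \<Rightarrow> real) \<Rightarrow> nat \<Rightarrow> real set" where
  "cell xi j = {xi (j - 1)..xi j}"

text \<open>An element of the space is an $L^2$ class, so a representative is constrained
  on the open cells only; its values at the interfaces are irrelevant. Square integrability on
  $[0,L]$ is automatic.\<close>

definition Vh :: "nat \<Rightarrow> (nat \<Rightarrow> real) \<Rightarrow> nat \<Rightarrow> (real \<Rightarrow> real) set" where
  "Vh Nx xi k = {u. \<forall>j\<in>{1..Nx}. \<exists>p :: real poly. degree p \<le> k \<and>
     (\<forall>y\<in>{xi (j - 1)<..<xi j}. u y = poly p y)}"

text \<open>Periodicity: nodes \<open>0\<close> and \<open>Nx\<close> are the same interface, with left trace taken at the right
  end of the last cell and right trace at the left end of the first cell.\<close>

definition left_trace :: "nat \<Rightarrow> (nat \<Rightarrow> real) \<Rightarrow> (real \<Rightarrow> real) \<Rightarrow> nat \<Rightarrow> real" where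
  "left_trace Nx xi u i = Lim (at_left (xi (if i = 0 then Nx else i))) u"

definition right_trace :: "nat \<Rightarrow> (nat \<Rightarrow> real) \<Rightarrow> (real \<Rightarrow> real) \<Rightarrow> nat \<Rightarrow> real" where
  "right_trace Nx xi u i = Lim (at_right (xi (if i = Nx then 0 else i))) u"

definition jump :: "nat \<Rightarrow> (nat \<Rightarrow> real) \<Rightarrow> (real \<Rightarrow> real) \<Rightarrow> nat \<Rightarrow> real" where
  "jump Nx xi u i = right_trace Nx xi u i - left_trace Nx xi u i"

definition average :: "nat \<Rightarrow> (nat \<Rightarrow> real) \<Rightarrow> (real \<Rightarrow> real) \<Rightarrow> nat \<Rightarrow> real" where
  "average Nx xi u i = (right_trace Nx xi u i + left_trace Nx xi u i) / 2"

text \<open>Continuous differentiability of a \<open>Vh\<close>-valued function on a time interval \<open>T\<close>,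
  with respect to the norm of $L^2(0,L)$; the derivative is one-sided at end points of \<open>T\<close>.\<close>

definition L2_norm_on :: "real \<Rightarrow> (real \<Rightarrow> real) \<Rightarrow> real" where
  "L2_norm_on L u = sqrt (integral {0..L} (\<lambda>y. (u y)\<^sup>2))"

definition C1_Vh ::
  "real \<Rightarrow> nat \<Rightarrow> (nat \<Rightarrow> real) \<Rightarrow> nat \<Rightarrow> real set \<Rightarrow> (real \<Rightarrow> real \<Rightarrow> real) \<Rightarrow> bool" where
  "C1_Vh L Nx xi k T u \<longleftrightarrow> (\<exists>D :: real \<Rightarrow> real \<Rightarrow> real.
     (\<forall>t\<in>T. u t \<in> Vh Nx xi k \<and> D t \<in> Vh Nx xi k) \<and>
     (\<forall>t\<in>T. ((\<lambda>s. L2_norm_on L (\<lambda>y. (u s y - u t y) / (s - t) - D t y)) \<longlongrightarrow> 0) (at t within T)) \<and>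
     (\<forall>t\<in>T. ((\<lambda>s. L2_norm_on L (\<lambda>y. D s y - D t y)) \<longlongrightarrow> 0) (at t within T)))"


section \<open>Fluxes and forms of the scheme\<close>

text \<open>Below, \<open>c n\<close>, \<open>e\<close> and \<open>f\<close> are the spatial functions $C_n$, $E$ and $\Phi$ at a fixed time.\<close>

definition coeff_ext :: "nat \<Rightarrow> (nat \<Rightarrow> real \<Rightarrow> real) \<Rightarrow> int \<Rightarrow> real \<Rightarrow> real" where
  "coeff_ext NH c m = (if 0 \<le> m \<and> m < int NH then c (nat m) else (\<lambda>y. 0))"

definition g_fun :: "real \<Rightarrow> nat \<Rightarrow> (nat \<Rightarrow> real \<Rightarrow> real) \<Rightarrow> nat \<Rightarrow> real \<Rightarrow> real" where
  "g_fun vth NH c n y = vth * (sqrt (real n + 1) * coeff_ext NH c (int n + 1) y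
                              + sqrt (real n) * coeff_ext NH c (int n - 1) y)"

definition g_flux ::
  "real \<Rightarrow> nat \<Rightarrow> nat \<Rightarrow> (nat \<Rightarrow> real) \<Rightarrow> (nat \<Rightarrow> real \<Rightarrow> real) \<Rightarrow> nat \<Rightarrow> nat \<Rightarrow> real" where
  "g_flux vth NH Nx xi c n i =
     (left_trace Nx xi (g_fun vth NH c n) i + right_trace Nx xi (g_fun vth NH c n) i
      - vth * sqrt (real NH) * (right_trace Nx xi (c n) i - left_trace Nx xi (c n) i)) / 2"

definition a_form ::
  "real \<Rightarrow> nat \<Rightarrow> nat \<Rightarrow> (nat \<Rightarrow> real) \<Rightarrow> (nat \<Rightarrow> real \<Rightarrow> real) \<Rightarrow> nat \<Rightarrow> nat \<Rightarrow> (real \<Rightarrow> real) \<Rightarrow> real" where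
  "a_form vth NH Nx xi c n j \<phi> =
     - integral (cell xi j) (\<lambda>y. g_fun vth NH c n y * deriv \<phi> y)
     + g_flux vth NH Nx xi c n j * left_trace Nx xi \<phi> j
     - g_flux vth NH Nx xi c n (j - 1) * right_trace Nx xi \<phi> (j - 1)"

definition C1_flux :: "real \<Rightarrow> nat \<Rightarrow> nat \<Rightarrow> (nat \<Rightarrow> real) \<Rightarrow> (nat \<Rightarrow> real \<Rightarrow> real) \<Rightarrow> nat \<Rightarrow> real" where
  "C1_flux vth NH Nx xi c i = g_flux vth NH Nx xi c 0 i / vth"

definition r_form ::
  "real \<Rightarrow> real \<Rightarrow> nat \<Rightarrow> nat \<Rightarrow> (nat \<Rightarrow> real) \<Rightarrow> (nat \<Rightarrow> real \<Rightarrow> real) \<Rightarrow> (real \<Rightarrow> real) \<Rightarrow> (real \<Rightarrow> real)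
   \<Rightarrow> nat \<Rightarrow> nat \<Rightarrow> (real \<Rightarrow> real) \<Rightarrow> real" where
  "r_form vth \<beta> NH Nx xi c e f n j \<phi> =
     (if n = 1 then
        - (\<beta> / (2 * vth\<^sup>2)) *
          (jump Nx xi f (j - 1) * jump Nx xi e (j - 1) * right_trace Nx xi \<phi> (j - 1)
           + jump Nx xi f j * jump Nx xi e j * left_trace Nx xi \<phi> j)
      else if n = 2 then
        1 / (sqrt 2 * vth) *
          ((average Nx xi (c 1) (j - 1) - C1_flux vth NH Nx xi c (j - 1))
             * jump Nx xi f (j - 1) * right_trace Nx xi \<phi> (j - 1)
           + (average Nx xi (c 1) j - C1_flux vth NH Nx xi c j)
             * jump Nx xi f j * left_trace Nx xi \<phi> j)
      else 0)"

definition Phi_flux :: "nat \<Rightarrow> (nat \<Rightarrow> real) \<Rightarrow> (real \<Rightarrow> real) \<Rightarrow> nat \<Rightarrow> real" where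
  "Phi_flux Nx xi f i = average Nx xi f i"

definition E_flux ::
  "real \<Rightarrow> nat \<Rightarrow> (nat \<Rightarrow> real) \<Rightarrow> (real \<Rightarrow> real) \<Rightarrow> (real \<Rightarrow> real) \<Rightarrow> nat \<Rightarrow> real" where
  "E_flux \<beta> Nx xi e f i = average Nx xi e i - \<beta> * jump Nx xi f i"

definition total_energy ::
  "real \<Rightarrow> real \<Rightarrow> real \<Rightarrow> nat \<Rightarrow> (nat \<Rightarrow> real) \<Rightarrow> (nat \<Rightarrow> real \<Rightarrow> real) \<Rightarrow> (real \<Rightarrow> real) \<Rightarrow> (real \<Rightarrow> real) \<Rightarrow> real"
  where
  "total_energy L vth \<beta> Nx xi c e f =
     1 / 2 * integral {0..L} (\<lambda>y. vth ^ 3 * (sqrt 2 * c 2 y + c 0 y) + \<bar>e y\<bar>\<^sup>2)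
     + 1 / 2 * \<beta> * (\<Sum>j=1..Nx. (jump Nx xi f (j - 1))\<^sup>2)"

end

theory Submission imports Defs begin

text \<open>
  Testing the Poisson equations at different times \<open>s\<close> and \<open>t\<close> gives
  $\int E_s E_t + \beta \sum [\Phi_s][\Phi_t] = \int (v_{th} C_{0,s} - \rho_0) \Phi_t$, which is
  symmetric in \<open>s\<close> and \<open>t\<close>. So the increment of the field energy from \<open>t\<close> to \<open>s\<close> is half of
  $v_{th} \int (C_{0,s} - C_{0,t})(\Phi_s + \Phi_t)$, and its time derivative
  $v_{th} \frac{d}{ds} \int C_{0,s} \Phi_t$ at $s = t$ is found without differentiating any
  trace of $E$ or $\Phi$. The equation for \<open>C\<^sub>0\<close> tested with $\Phi$ and the first Poisson equation
  tested with \<open>C\<^sub>1\<close> show that it cancels the kinetic contribution of \<open>C\<^sub>2\<close>. For momentum,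
  the second Poisson equation is tested with $E$.
\<close>

section \<open>Functions polynomial on each open cell, with no degree bound so that products stay in
  the class\<close>

definition pwpoly :: "nat \<Rightarrow> (nat \<Rightarrow> real) \<Rightarrow> (real \<Rightarrow> real) \<Rightarrow> bool" where
  "pwpoly Nx xi u \<longleftrightarrow>
     (\<forall>j\<in>{1..Nx}. \<exists>p :: real poly. \<forall>y\<in>{xi (j - 1)<..<xi j}. u y = poly p y)"

lemma pwpolyE:
  assumes "pwpoly Nx xi u" "j \<in> {1..Nx}"
  obtains p :: "real poly" where "\<And>y. y \<in> {xi (j - 1)<..<xi j} \<Longrightarrow> u y = poly p y"
  using assms unfolding pwpoly_def by blast

lemma pwpoly_Vh: "u \<in> Vh Nx xi k \<Longrightarrow> pwpoly Nx xi u"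
  unfolding Vh_def pwpoly_def by blast

lemma const_in_Vh: "(\<lambda>y. c) \<in> Vh Nx xi k"
  unfolding Vh_def by (auto intro!: exI[of _ "[:c:]"])

lemma pwpoly_const: "pwpoly Nx xi (\<lambda>y. c)"
  using const_in_Vh by (rule pwpoly_Vh)

lemma pwpoly_add:
  assumes "pwpoly Nx xi u" "pwpoly Nx xi v"
  shows "pwpoly Nx xi (\<lambda>y. u y + v y)"
  unfolding pwpoly_def
proof
  fix j assume j: "j \<in> {1..Nx}"
  obtain p q :: "real poly" where "\<And>y. y \<in> {xi (j - 1)<..<xi j} \<Longrightarrow> u y = poly p y"
    "\<And>y. y \<in> {xi (j - 1)<..<xi j} \<Longrightarrow> v y = poly q y"
    using assms j by (metis pwpolyE)
  then show "\<exists>p. \<forall>y\<in>{xi (j - 1)<..<xi j}. u y + v y = poly p y"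
    by (intro exI[of _ "p + q"]) simp
qed

lemma pwpoly_mult:
  assumes "pwpoly Nx xi u" "pwpoly Nx xi v"
  shows "pwpoly Nx xi (\<lambda>y. u y * v y)"
  unfolding pwpoly_def
proof
  fix j assume j: "j \<in> {1..Nx}"
  obtain p q :: "real poly" where "\<And>y. y \<in> {xi (j - 1)<..<xi j} \<Longrightarrow> u y = poly p y"
    "\<And>y. y \<in> {xi (j - 1)<..<xi j} \<Longrightarrow> v y = poly q y"
    using assms j by (metis pwpolyE)
  then show "\<exists>p. \<forall>y\<in>{xi (j - 1)<..<xi j}. u y * v y = poly p y"
    by (intro exI[of _ "p * q"]) simp
qed

lemma pwpoly_cmult: "pwpoly Nx xi u \<Longrightarrow> pwpoly Nx xi (\<lambda>y. c * u y)"
  by (intro pwpoly_mult pwpoly_const)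

lemma pwpoly_diff:
  "pwpoly Nx xi u \<Longrightarrow> pwpoly Nx xi v \<Longrightarrow> pwpoly Nx xi (\<lambda>y. u y - v y)"
  using pwpoly_add[of Nx xi u "\<lambda>y. (-1) * v y"] pwpoly_cmult[of Nx xi v "-1"] by simp

lemma pwpoly_divide: "pwpoly Nx xi u \<Longrightarrow> pwpoly Nx xi (\<lambda>y. u y / c)"
  using pwpoly_cmult[of Nx xi u "inverse c"] by (simp add: field_simps)

lemma pwpoly_power: "pwpoly Nx xi u \<Longrightarrow> pwpoly Nx xi (\<lambda>y. u y ^ n)"
  by (induction n) (auto intro: pwpoly_const pwpoly_mult)

text \<open>\<open>deriv\<close> depends only on values near the point, so inside an open cell it
  sees the polynomial alone, whatever the representative does at the interfaces.\<close>

lemma deriv_eq_pderiv: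
  fixes a b :: real
  assumes "\<And>y. y \<in> {a<..<b} \<Longrightarrow> u y = poly p y" "y \<in> {a<..<b}"
  shows "deriv u y = poly (pderiv p) y"
proof -
  have "(u has_field_derivative poly (pderiv p) y) (at y)"
    by (rule has_field_derivative_transform_within_open[OF poly_DERIV[of p y] open_greaterThanLessThan assms(2)])
      (use assms in auto)
  then show ?thesis by (rule DERIV_imp_deriv)
qed

lemma pwpoly_deriv:
  assumes "pwpoly Nx xi u"
  shows "pwpoly Nx xi (deriv u)"
  unfolding pwpoly_def
proof
  fix j assume "j \<in> {1..Nx}"
  then obtain p where "\<And>y. y \<in> {xi (j - 1)<..<xi j} \<Longrightarrow> u y = poly p y"
    using assms by (metis pwpolyE)
  then show "\<exists>q. \<forall>y\<in>{xi (j - 1)<..<xi j}. deriv u y = poly q y"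
    using deriv_eq_pderiv by blast
qed

lemmas pwpoly_intros = pwpoly_const pwpoly_add pwpoly_mult pwpoly_diff pwpoly_divide
  pwpoly_power pwpoly_deriv

text \<open>The two end points, where a representative is arbitrary, form a finite set and do not
  affect the integral.\<close>

lemma pwpoly_has_integral_cell:
  assumes "j \<in> {1..Nx}" "\<And>y. y \<in> {xi (j - 1)<..<xi j} \<Longrightarrow> u y = poly p y"
    "(poly p has_integral I) (cell xi j)"
  shows "(u has_integral I) (cell xi j)"
proof (rule has_integral_spike_finite[OF _ _ assms(3)])
  show "finite {xi (j - 1), xi j}" by simp
  show "u y = poly p y" if "y \<in> cell xi j - {xi (j - 1), xi j}" for y
    using that assms(2) by (auto simp: cell_def)
qed

lemma pwpoly_integrable_cell:
  assumes "pwpoly Nx xi u" "j \<in> {1..Nx}"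
  shows "u integrable_on cell xi j"
proof -
  obtain p where p: "\<And>y. y \<in> {xi (j - 1)<..<xi j} \<Longrightarrow> u y = poly p y"
    using assms by (metis pwpolyE)
  have "poly p integrable_on cell xi j"
    unfolding cell_def by (intro integrable_continuous_interval continuous_intros)
  then show ?thesis
    using pwpoly_has_integral_cell[of j Nx xi u p] assms(2) p by blast
qed

section \<open>Periodic summation over interfaces\<close>

lemma traces_periodic:
  "left_trace Nx xi u 0 = left_trace Nx xi u Nx"
  "right_trace Nx xi u 0 = right_trace Nx xi u Nx"
  by (simp_all add: left_trace_def right_trace_def)

lemma sum_periodic_shift:
  fixes F :: "nat \<Rightarrow> real"
  assumes "F 0 = F n"
  shows "(\<Sum>j=1..n. F (j - 1)) = (\<Sum>j=1..n. F j)"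
proof -
  \<comment> \<open>For general \<open>m\<close> the shift costs the two end terms; periodicity
    makes them equal at \<open>m = n\<close>.\<close>
  have "(\<Sum>j=1..m. F (j - 1)) + F m = F 0 + (\<Sum>j=1..m. F j)" for m
    by (induction m) simp_all
  from this[of n] assms show ?thesis by simp
qed

lemma sum_periodic_neighbours:
  fixes F :: "nat \<Rightarrow> real"
  assumes "F 0 = F n"
  shows "(\<Sum>j=1..n. b * (F (j - 1) + F j)) = 2 * b * (\<Sum>j=1..n. F j)"
  unfolding sum_distrib_left[symmetric] sum.distrib sum_periodic_shift[of F, OF assms] by simp

text \<open>\<open>F\<close> has one value per interface, so the two cells meeting there contribute
  \<open>F\<close> times the left trace minus \<open>F\<close> times the right trace.\<close>

lemma sum_flux_trace:
  fixes F :: "nat \<Rightarrow> real"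
  assumes "F 0 = F Nx"
  shows "(\<Sum>j=1..Nx. F j * left_trace Nx xi v j - F (j - 1) * right_trace Nx xi v (j - 1))
       = - (\<Sum>j=1..Nx. F j * jump Nx xi v j)"
proof -
  have "(\<Sum>j=1..Nx. F (j - 1) * right_trace Nx xi v (j - 1)) = (\<Sum>j=1..Nx. F j * right_trace Nx xi v j)"
    by (rule sum_periodic_shift[where F = "\<lambda>j. F j * right_trace Nx xi v j"])
      (simp add: assms traces_periodic)
  then show ?thesis
    by (simp add: sum_subtractf jump_def right_diff_distrib)
qed

text \<open>After regrouping by interface this is the product rule [uv] = {u}[v] + [u]{v} for
  jumps.\<close>

lemma sum_trace_difference:
  "(\<Sum>j=1..Nx. left_trace Nx xi u j * left_trace Nx xi v j
               - right_trace Nx xi u (j - 1) * right_trace Nx xi v (j - 1))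
   = - (\<Sum>j=1..Nx. average Nx xi u j * jump Nx xi v j + jump Nx xi u j * average Nx xi v j)"
proof -
  have *: "(\<Sum>j=1..Nx. right_trace Nx xi u (j - 1) * right_trace Nx xi v (j - 1))
      = (\<Sum>j=1..Nx. right_trace Nx xi u j * right_trace Nx xi v j)"
    by (rule sum_periodic_shift[where F = "\<lambda>j. right_trace Nx xi u j * right_trace Nx xi v j"])
      (simp add: traces_periodic)
  show ?thesis
    unfolding sum_subtractf * unfolding sum_subtractf[symmetric] sum_negf[symmetric]
    by (rule sum.cong) (simp_all add: average_def jump_def field_simps)
qed

lemma jump_average_periodic:
  "jump Nx xi u 0 = jump Nx xi u Nx" "average Nx xi u 0 = average Nx xi u Nx"
  by (simp_all add: jump_def average_def traces_periodic)

lemma g_flux_periodic: "g_flux vth NH Nx xi c n 0 = g_flux vth NH Nx xi c n Nx"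
  by (simp add: g_flux_def traces_periodic)

section \<open>Integration over the mesh, traces and integration by parts\<close>

locale periodic_mesh =
  fixes L :: real and Nx :: nat and xi :: "nat \<Rightarrow> real"
  assumes mesh: "mesh L Nx xi"
begin

lemma cell_less: "j \<in> {1..Nx} \<Longrightarrow> xi (j - 1) < xi j"
  using mesh unfolding mesh_def by (cases j) auto

text \<open>Cells are glued one at a time; \<open>0 \<le> xi i\<close> is carried along as the
  ordering needed to combine adjacent intervals.\<close>

lemma pwpoly_integral_partial:
  assumes "pwpoly Nx xi u" "i \<le> Nx"
  shows "0 \<le> xi i \<and> (u has_integral (\<Sum>j=1..i. integral (cell xi j) u)) {0..xi i}"
  using assms(2)
proof (induction i)
  case 0
  then show ?case using mesh has_integral_refl(2)[of u 0] by (simp add: mesh_def)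
next
  case (Suc i)
  have less: "xi i < xi (Suc i)" using cell_less[of "Suc i"] Suc.prems by simp
  have "(u has_integral integral (cell xi (Suc i)) u) {xi i..xi (Suc i)}"
    using pwpoly_integrable_cell[OF assms(1), of "Suc i"] Suc.prems
    by (simp add: cell_def has_integral_integral)
  then have "(u has_integral (\<Sum>j=1..i. integral (cell xi j) u) + integral (cell xi (Suc i)) u)
      {0..xi (Suc i)}"
    using Suc less by (intro has_integral_combine[of 0 "xi i"]) auto
  then show ?case using Suc less by auto
qed

lemma pwpoly_has_integral:
  assumes "pwpoly Nx xi u"
  shows "(u has_integral (\<Sum>j=1..Nx. integral (cell xi j) u)) {0..L}"
  using pwpoly_integral_partial[OF assms order_refl] mesh by (simp add: mesh_def)

lemma pwpoly_integrable: "pwpoly Nx xi u \<Longrightarrow> u integrable_on {0..L}"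
  using pwpoly_has_integral by blast

lemma integral_eq_sum_cells:
  "pwpoly Nx xi u \<Longrightarrow> integral {0..L} u = (\<Sum>j=1..Nx. integral (cell xi j) u)"
  using pwpoly_has_integral by blast

lemma trace_eq_poly:
  assumes j: "j \<in> {1..Nx}" and p: "\<And>y. y \<in> {xi (j - 1)<..<xi j} \<Longrightarrow> u y = poly p y"
  shows "left_trace Nx xi u j = poly p (xi j)"
    and "right_trace Nx xi u (j - 1) = poly p (xi (j - 1))"
proof -
  have less: "xi (j - 1) < xi j" using cell_less j by simp
  have "\<forall>\<^sub>F y in at_left (xi j). poly p y = u y"
    using p eventually_at_left_real[OF less] by (auto elim!: eventually_mono)
  moreover have "(poly p \<longlongrightarrow> poly p (xi j)) (at_left (xi j))"
    by (intro tendsto_intros)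
  ultimately have "(u \<longlongrightarrow> poly p (xi j)) (at_left (xi j))"
    by (rule Lim_transform_eventually[rotated])
  then show "left_trace Nx xi u j = poly p (xi j)"
    using j by (auto simp: left_trace_def intro!: tendsto_Lim)
  have "\<forall>\<^sub>F y in at_right (xi (j - 1)). poly p y = u y"
    using p eventually_at_right_real[OF less] by (auto elim!: eventually_mono)
  moreover have "(poly p \<longlongrightarrow> poly p (xi (j - 1))) (at_right (xi (j - 1)))"
    by (intro tendsto_intros)
  ultimately have "(u \<longlongrightarrow> poly p (xi (j - 1))) (at_right (xi (j - 1)))"
    by (rule Lim_transform_eventually[rotated])
  \<comment> \<open>Node \<open>j - 1\<close> is never the last one, so the periodic branch of
    \<open>right_trace\<close> does not apply.\<close>
  moreover have "j - 1 \<noteq> Nx" using j by auto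
  ultimately show "right_trace Nx xi u (j - 1) = poly p (xi (j - 1))"
    by (auto simp: right_trace_def intro!: tendsto_Lim)
qed

lemma trace_one:
  assumes "j \<in> {1..Nx}"
  shows "left_trace Nx xi (\<lambda>y. 1) j = 1" "right_trace Nx xi (\<lambda>y. 1) (j - 1) = 1"
  using trace_eq_poly[of j "\<lambda>y. 1" 1] assms by auto

text \<open>This is the fundamental theorem of calculus for the product of the two cell polynomials,
  whose end point values are products of one-sided traces.\<close>

lemma integral_by_parts_cell:
  assumes u: "pwpoly Nx xi u" and v: "pwpoly Nx xi v" and j: "j \<in> {1..Nx}"
  shows "integral (cell xi j) (\<lambda>y. u y * deriv v y) + integral (cell xi j) (\<lambda>y. deriv u y * v y)
    = left_trace Nx xi u j * left_trace Nx xi v j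
      - right_trace Nx xi u (j - 1) * right_trace Nx xi v (j - 1)"
proof -
  obtain p where p: "\<And>y. y \<in> {xi (j - 1)<..<xi j} \<Longrightarrow> u y = poly p y"
    using u j by (metis pwpolyE)
  obtain q where q: "\<And>y. y \<in> {xi (j - 1)<..<xi j} \<Longrightarrow> v y = poly q y"
    using v j by (metis pwpolyE)
  have "(poly (pderiv (p * q)) has_integral poly (p * q) (xi j) - poly (p * q) (xi (j - 1)))
      (cell xi j)"
    unfolding cell_def
  proof (rule fundamental_theorem_of_calculus)
    show "xi (j - 1) \<le> xi j" using cell_less[OF j] by simp
    show "(poly (p * q) has_vector_derivative poly (pderiv (p * q)) y) (at y within {xi (j - 1)..xi j})"
      for y
      unfolding has_real_derivative_iff_has_vector_derivative[symmetric]
      by (rule has_field_derivative_at_within[OF poly_DERIV])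
  qed
  then have "((\<lambda>y. u y * deriv v y + deriv u y * v y) has_integral
      poly (p * q) (xi j) - poly (p * q) (xi (j - 1))) (cell xi j)"
  proof (rule pwpoly_has_integral_cell[OF j, rotated])
    fix y assume y: "y \<in> {xi (j - 1)<..<xi j}"
    have "deriv u y = poly (pderiv p) y" "deriv v y = poly (pderiv q) y"
      using deriv_eq_pderiv p q y by blast+
    then show "u y * deriv v y + deriv u y * v y = poly (pderiv (p * q)) y"
      by (simp add: p[OF y] q[OF y] pderiv_mult)
  qed
  then have "integral (cell xi j) (\<lambda>y. u y * deriv v y + deriv u y * v y)
      = poly (p * q) (xi j) - poly (p * q) (xi (j - 1))"
    by (rule integral_unique)
  then show ?thesis
    using pwpoly_integrable_cell[OF pwpoly_mult[OF u pwpoly_deriv[OF v]] j]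
      pwpoly_integrable_cell[OF pwpoly_mult[OF pwpoly_deriv[OF u] v] j]
      trace_eq_poly[of j u p, OF j] trace_eq_poly[of j v q, OF j] p q
    by (simp add: integral_add)
qed

lemma integral_by_parts:
  assumes u: "pwpoly Nx xi u" and v: "pwpoly Nx xi v"
  shows "integral {0..L} (\<lambda>y. u y * deriv v y) + integral {0..L} (\<lambda>y. deriv u y * v y)
    = - (\<Sum>j=1..Nx. average Nx xi u j * jump Nx xi v j + jump Nx xi u j * average Nx xi v j)"
proof -
  have "integral {0..L} (\<lambda>y. u y * deriv v y) + integral {0..L} (\<lambda>y. deriv u y * v y)
      = (\<Sum>j=1..Nx. integral (cell xi j) (\<lambda>y. u y * deriv v y)
                  + integral (cell xi j) (\<lambda>y. deriv u y * v y))"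
    using u v by (simp add: integral_eq_sum_cells pwpoly_intros sum.distrib)
  also have "\<dots> = (\<Sum>j=1..Nx. left_trace Nx xi u j * left_trace Nx xi v j
      - right_trace Nx xi u (j - 1) * right_trace Nx xi v (j - 1))"
    by (rule sum.cong) (simp_all add: integral_by_parts_cell u v)
  finally show ?thesis by (simp only: sum_trace_difference)
qed

section \<open>Time derivatives of quadratic quantities\<close>

lemma C1_Vh_quotient_bounded:
  assumes u: "C1_Vh L Nx xi k T u" and t: "t \<in> T"
  shows "\<exists>M. \<forall>\<^sub>F s in at t within T. integral {0..L} (\<lambda>y. ((u s y - u t y) / (s - t))\<^sup>2) \<le> M"
proof -
  obtain D where V: "\<And>s. s \<in> T \<Longrightarrow> u s \<in> Vh Nx xi k \<and> D s \<in> Vh Nx xi k"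
    and lim: "((\<lambda>s. L2_norm_on L (\<lambda>y. (u s y - u t y) / (s - t) - D t y)) \<longlongrightarrow> 0) (at t within T)"
    using u t unfolding C1_Vh_def by blast
  have pw: "pwpoly Nx xi (u s)" "pwpoly Nx xi (D s)" if "s \<in> T" for s
    using V that by (auto intro: pwpoly_Vh)
  \<comment> \<open>Any positive threshold would do: once the quotient is this close to
    \<open>D t\<close> in L2, its size is controlled by that of \<open>D t\<close>.\<close>
  have "\<forall>\<^sub>F s in at t within T. L2_norm_on L (\<lambda>y. (u s y - u t y) / (s - t) - D t y) < 1"
    using lim by (rule order_tendstoD) simp
  moreover have "\<forall>\<^sub>F s in at t within T. s \<in> T"
    by (simp add: eventually_at_filter)
  ultimately have "\<forall>\<^sub>F s in at t within T. integral {0..L} (\<lambda>y. ((u s y - u t y) / (s - t))\<^sup>2)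
      \<le> 2 * 1 + 2 * integral {0..L} (\<lambda>y. (D t y)\<^sup>2)"
  proof eventually_elim
    case (elim s)
    let ?q = "\<lambda>y. (u s y - u t y) / (s - t)"
    have q: "pwpoly Nx xi ?q" using elim t by (intro pwpoly_intros pw)
    note I = pwpoly_integrable[OF pwpoly_cmult[OF pwpoly_power]]
    have "integral {0..L} (\<lambda>y. (?q y)\<^sup>2)
        \<le> integral {0..L} (\<lambda>y. 2 * (?q y - D t y)\<^sup>2 + 2 * (D t y)\<^sup>2)"
    proof (rule integral_le)
      show "(\<lambda>y. (?q y)\<^sup>2) integrable_on {0..L}"
        by (intro pwpoly_integrable pwpoly_intros pw elim t)
      show "(\<lambda>y. 2 * (?q y - D t y)\<^sup>2 + 2 * (D t y)\<^sup>2) integrable_on {0..L}"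
        by (intro pwpoly_integrable pwpoly_intros pw elim t)
      \<comment> \<open>The right side minus the left side is the square of
        \<open>a - 2 * d\<close>.\<close>
      have "a\<^sup>2 \<le> 2 * (a - d)\<^sup>2 + 2 * d\<^sup>2" for a d :: real
        using zero_le_power2[of "a - 2 * d"] by (simp add: power2_eq_square algebra_simps)
      then show "(?q y)\<^sup>2 \<le> 2 * (?q y - D t y)\<^sup>2 + 2 * (D t y)\<^sup>2" for y .
    qed
    also have "\<dots> = 2 * integral {0..L} (\<lambda>y. (?q y - D t y)\<^sup>2) + 2 * integral {0..L} (\<lambda>y. (D t y)\<^sup>2)"
      by (subst integral_add)
        (intro I pwpoly_diff q pw t | simp)+
    also have "integral {0..L} (\<lambda>y. (?q y - D t y)\<^sup>2) \<le> 1"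
      using elim(1) by (simp add: L2_norm_on_def)
    finally show ?case by simp
  qed
  then show ?thesis by blast
qed

text \<open>Both difference quotients stay bounded in L2, so the product of the increments is of
  second order in \<open>s - t\<close>.\<close>

lemma C1_Vh_product_remainder:
  assumes u: "C1_Vh L Nx xi k T u" and v: "C1_Vh L Nx xi k T v" and t: "t \<in> T"
  shows "((\<lambda>s. integral {0..L} (\<lambda>y. (u s y - u t y) * (v s y - v t y)) / (s - t)) \<longlongrightarrow> 0)
    (at t within T)"
proof -
  obtain M where M: "\<forall>\<^sub>F s in at t within T. integral {0..L} (\<lambda>y. ((u s y - u t y) / (s - t))\<^sup>2) \<le> M"
    using C1_Vh_quotient_bounded[OF u t] by blast
  obtain M' where M': "\<forall>\<^sub>F s in at t within T. integral {0..L} (\<lambda>y. ((v s y - v t y) / (s - t))\<^sup>2) \<le> M'"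
    using C1_Vh_quotient_bounded[OF v t] by blast
  have pw: "pwpoly Nx xi (u s)" "pwpoly Nx xi (v s)" if "s \<in> T" for s
    using u v that unfolding C1_Vh_def by (auto intro: pwpoly_Vh)
  have "\<forall>\<^sub>F s in at t within T. s \<in> T \<and> s \<noteq> t"
    by (simp add: eventually_at_filter)
  with M M' have bound: "\<forall>\<^sub>F s in at t within T.
      norm (integral {0..L} (\<lambda>y. (u s y - u t y) * (v s y - v t y)) / (s - t))
      \<le> \<bar>s - t\<bar> * (M + M')"
  proof eventually_elim
    case (elim s)
    let ?a = "\<lambda>y. (u s y - u t y) / (s - t)" and ?b = "\<lambda>y. (v s y - v t y) / (s - t)"
    have s: "s \<in> T" "s \<noteq> t" using elim by auto
    have int: "(\<lambda>y. (?a y)\<^sup>2 + (?b y)\<^sup>2) integrable_on {0..L}"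
      "(\<lambda>y. (?a y)\<^sup>2) integrable_on {0..L}" "(\<lambda>y. (?b y)\<^sup>2) integrable_on {0..L}"
      "(\<lambda>y. ?a y * ?b y) integrable_on {0..L}"
      by (intro pwpoly_integrable pwpoly_intros pw s t)+
    \<comment> \<open>This crude pointwise bound does the work of the Cauchy-Schwarz
      inequality.\<close>
    have ab: "\<bar>a * b\<bar> \<le> a\<^sup>2 + b\<^sup>2" for a b :: real
      using sum_squares_bound[of "\<bar>a\<bar>" "\<bar>b\<bar>"] mult_nonneg_nonneg[of "\<bar>a\<bar>" "\<bar>b\<bar>"]
      by (simp only: abs_mult power2_abs) linarith
    have "norm (integral {0..L} (\<lambda>y. ?a y * ?b y)) \<le> integral {0..L} (\<lambda>y. (?a y)\<^sup>2 + (?b y)\<^sup>2)"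
      by (rule integral_norm_bound_integral[OF int(4,1)]) (simp only: real_norm_def ab)
    also have "\<dots> \<le> M + M'"
      using elim by (simp only: integral_add[OF int(2,3)])
    finally have "norm (integral {0..L} (\<lambda>y. ?a y * ?b y)) \<le> M + M'" .
    \<comment> \<open>Each quotient absorbs one factor \<open>s - t\<close>; with a single division
      on the left, one factor is left over and drives the limit to zero.\<close>
    moreover have "integral {0..L} (\<lambda>y. (u s y - u t y) * (v s y - v t y)) / (s - t)
        = (s - t) * integral {0..L} (\<lambda>y. ?a y * ?b y)"
    proof -
      have "(\<lambda>y. ?a y * ?b y) = (\<lambda>y. (u s y - u t y) * (v s y - v t y) / (s - t)\<^sup>2)"
        by (simp add: power2_eq_square)
      then show ?thesis
        using s by (simp only: integral_divide) (simp add: power2_eq_square)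
    qed
    ultimately show ?case
      using mult_left_mono[of "\<bar>integral {0..L} (\<lambda>y. ?a y * ?b y)\<bar>" "M + M'" "\<bar>s - t\<bar>"]
      by (simp only: real_norm_def abs_mult abs_ge_zero)
  qed
  have "((\<lambda>s. \<bar>s - t\<bar> * (M + M')) \<longlongrightarrow> \<bar>t - t\<bar> * (M + M')) (at t within T)"
    by (intro tendsto_intros)
  then show ?thesis
    using bound by (auto intro: Lim_null_comparison)
qed

text \<open>Symmetry trades a change of the second argument for a change of the first, so the
  diagonal derivative is twice the derivative in the first argument with the second frozen at
  \<open>t\<close>. The error is the product of the increments of \<open>u\<close> and
  \<open>v\<close>.\<close>

lemma symmetric_form_has_derivative:
  assumes u: "C1_Vh L Nx xi k T u" and v: "C1_Vh L Nx xi k T v" and t: "t \<in> T"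
    and sym: "\<And>s r. s \<in> T \<Longrightarrow> r \<in> T \<Longrightarrow> Q s r = Q r s"
    and Q: "\<And>s r. s \<in> T \<Longrightarrow> r \<in> T \<Longrightarrow> Q s r = integral {0..L} (\<lambda>y. (a * u s y - b) * v r y)"
    and K: "((\<lambda>s. integral {0..L} (\<lambda>y. u s y * v t y)) has_real_derivative K) (at t within T)"
  shows "((\<lambda>s. Q s s) has_real_derivative 2 * a * K) (at t within T)"
proof -
  have pw: "pwpoly Nx xi (u s)" "pwpoly Nx xi (v s)" if "s \<in> T" for s
    using u v that unfolding C1_Vh_def by (auto intro: pwpoly_Vh)
  let ?I = "\<lambda>s r. integral {0..L} (\<lambda>y. u s y * v r y)"
  let ?R = "\<lambda>s. integral {0..L} (\<lambda>y. (u s y - u t y) * (v s y - v t y))"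
  \<comment> \<open>The \<open>b\<close> term depends only on the second argument and drops out of
    an increment in the first.\<close>
  have diff: "Q s r - Q t r = a * (?I s r - ?I t r)" if "s \<in> T" "r \<in> T" for s r
  proof -
    have *: "Q s' r = a * ?I s' r - b * integral {0..L} (v r)" if s': "s' \<in> T" for s'
    proof -
      have "Q s' r = integral {0..L} (\<lambda>y. a * (u s' y * v r y) - b * v r y)"
        using Q[OF s' \<open>r \<in> T\<close>] by (simp add: algebra_simps)
      also have "\<dots> = integral {0..L} (\<lambda>y. a * (u s' y * v r y)) - integral {0..L} (\<lambda>y. b * v r y)"
        by (intro integral_diff pwpoly_integrable pwpoly_cmult pwpoly_mult pw that \<open>r \<in> T\<close>)
      finally show ?thesis by simp
    qed
    show ?thesis using *[OF \<open>s \<in> T\<close>] *[OF t] by (simp add: right_diff_distrib)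
  qed
  have R: "?R s = ?I s s - ?I s t - (?I t s - ?I t t)" if "s \<in> T" for s
  proof -
    have "?R s = integral {0..L} (\<lambda>y. (u s y * v s y - u s y * v t y) - (u t y * v s y - u t y * v t y))"
      by (simp add: algebra_simps)
    also have "\<dots> = ?I s s - ?I s t - (?I t s - ?I t t)"
      using that t by (simp add: integral_diff pwpoly_integrable pwpoly_mult pwpoly_diff pw)
    finally show ?thesis .
  qed
  have "((\<lambda>s. 2 * a * ((?I s t - ?I t t) / (s - t)) + a * (?R s / (s - t)))
      \<longlongrightarrow> 2 * a * K + a * 0) (at t within T)"
    using K C1_Vh_product_remainder[OF u v t]
    by (intro tendsto_intros) (simp_all add: has_field_derivative_iff)
  moreover have "\<forall>\<^sub>F s in at t within T. 2 * a * ((?I s t - ?I t t) / (s - t)) + a * (?R s / (s - t))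
      = (Q s s - Q t t) / (s - t)"
  proof -
    have "2 * a * ((?I s t - ?I t t) / (s - t)) + a * (?R s / (s - t)) = (Q s s - Q t t) / (s - t)"
      if s: "s \<in> T" for s
    proof -
      \<comment> \<open>Inserting \<open>Q s t\<close>, which equals \<open>Q t s\<close>, splits
        the diagonal increment into two increments of the first argument.\<close>
      have "Q s s - Q t t = (Q s s - Q t s) + (Q s t - Q t t)"
        using sym[OF s t] by simp
      also have "\<dots> = 2 * a * (?I s t - ?I t t) + a * ?R s"
        unfolding diff[OF s s] diff[OF s t] R[OF s] by (simp add: algebra_simps)
      finally show ?thesis by (simp add: add_divide_distrib)
    qed
    then show ?thesis by (simp add: eventually_at_filter)
  qed
  ultimately have "((\<lambda>s. (Q s s - Q t t) / (s - t)) \<longlongrightarrow> 2 * a * K + a * 0) (at t within T)"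
    by (rule Lim_transform_eventually)
  then show ?thesis by (simp add: has_field_derivative_iff)
qed

section \<open>Equations of the scheme summed over all cells\<close>

lemma jump_one: "j \<in> {1..Nx} \<Longrightarrow> jump Nx xi (\<lambda>y. 1) j = 0"
proof -
  assume j: "j \<in> {1..Nx}"
  have "right_trace Nx xi (\<lambda>y. 1) j = 1"
  \<comment> \<open>At the last node the right trace wraps around to the first cell; elsewhere it
    comes from cell \<open>Suc j\<close>.\<close>
  proof (cases "j = Nx")
    case True
    then show ?thesis using trace_one(2)[of 1] j by (simp add: traces_periodic)
  next
    case False
    then show ?thesis using trace_one(2)[of "Suc j"] j by simp
  qed
  then show ?thesis using trace_one(1)[OF j] by (simp add: jump_def)
qed

text \<open>Integrating by parts moves the derivative to \<open>f\<close>, and the central flux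
  cancels the terms with the average of \<open>f\<close>. What is left has the shape of the
  divergence equation tested with \<open>f\<close>.\<close>

lemma gradient_equation_summed:
  assumes pw: "pwpoly Nx xi f" "pwpoly Nx xi e" "pwpoly Nx xi v"
    and eq: "\<And>j. j \<in> {1..Nx} \<Longrightarrow>
      integral (cell xi j) (\<lambda>y. f y * deriv v y)
        - Phi_flux Nx xi f j * left_trace Nx xi v j
        + Phi_flux Nx xi f (j - 1) * right_trace Nx xi v (j - 1)
      = integral (cell xi j) (\<lambda>y. e y * v y)"
  shows "integral {0..L} (\<lambda>y. e y * v y)
    = - integral {0..L} (\<lambda>y. deriv f y * v y) - (\<Sum>j=1..Nx. jump Nx xi f j * average Nx xi v j)"
proof -
  have "integral {0..L} (\<lambda>y. e y * v y) = (\<Sum>j=1..Nx. integral (cell xi j) (\<lambda>y. e y * v y))"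
    by (intro integral_eq_sum_cells pwpoly_mult pw)
  also have "\<dots> = (\<Sum>j=1..Nx. integral (cell xi j) (\<lambda>y. f y * deriv v y)
      - (Phi_flux Nx xi f j * left_trace Nx xi v j
         - Phi_flux Nx xi f (j - 1) * right_trace Nx xi v (j - 1)))"
    by (rule sum.cong) (simp_all flip: eq)
  also have "\<dots> = integral {0..L} (\<lambda>y. f y * deriv v y)
      - (\<Sum>j=1..Nx. Phi_flux Nx xi f j * left_trace Nx xi v j
         - Phi_flux Nx xi f (j - 1) * right_trace Nx xi v (j - 1))"
    by (simp add: sum_subtractf integral_eq_sum_cells pwpoly_intros pw)
  also have "\<dots> = integral {0..L} (\<lambda>y. f y * deriv v y)
      + (\<Sum>j=1..Nx. average Nx xi f j * jump Nx xi v j)"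
    by (subst sum_flux_trace) (simp_all add: Phi_flux_def jump_average_periodic)
  finally show ?thesis
    using integral_by_parts[OF pw(1,3)] by (simp add: sum.distrib)
qed

text \<open>The derivative stays on \<open>z\<close>: when \<open>z\<close> is a potential, the
  volume and average terms match those of the summed gradient equation, and only the penalty
  survives in the difference.\<close>

lemma divergence_equation_summed:
  assumes pw: "pwpoly Nx xi e" "pwpoly Nx xi w" "pwpoly Nx xi z"
    and eq: "\<And>j. j \<in> {1..Nx} \<Longrightarrow>
      - integral (cell xi j) (\<lambda>y. e y * deriv z y)
        + E_flux \<beta> Nx xi e f j * left_trace Nx xi z j
        - E_flux \<beta> Nx xi e f (j - 1) * right_trace Nx xi z (j - 1)
      = integral (cell xi j) (\<lambda>y. w y * z y)"
  shows "integral {0..L} (\<lambda>y. w y * z y)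
    = - integral {0..L} (\<lambda>y. e y * deriv z y) - (\<Sum>j=1..Nx. average Nx xi e j * jump Nx xi z j)
      + \<beta> * (\<Sum>j=1..Nx. jump Nx xi f j * jump Nx xi z j)"
proof -
  have "integral {0..L} (\<lambda>y. w y * z y) = (\<Sum>j=1..Nx. integral (cell xi j) (\<lambda>y. w y * z y))"
    by (intro integral_eq_sum_cells pwpoly_mult pw)
  also have "\<dots> = (\<Sum>j=1..Nx. - integral (cell xi j) (\<lambda>y. e y * deriv z y)
      + (E_flux \<beta> Nx xi e f j * left_trace Nx xi z j
         - E_flux \<beta> Nx xi e f (j - 1) * right_trace Nx xi z (j - 1)))"
    by (rule sum.cong) (simp_all flip: eq)
  also have "\<dots> = - integral {0..L} (\<lambda>y. e y * deriv z y)
      + (\<Sum>j=1..Nx. E_flux \<beta> Nx xi e f j * left_trace Nx xi z j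
         - E_flux \<beta> Nx xi e f (j - 1) * right_trace Nx xi z (j - 1))"
    by (simp only: sum.distrib sum_negf integral_eq_sum_cells pwpoly_intros pw)
  also have "\<dots> = - integral {0..L} (\<lambda>y. e y * deriv z y)
      - (\<Sum>j=1..Nx. E_flux \<beta> Nx xi e f j * jump Nx xi z j)"
    by (subst sum_flux_trace) (simp_all add: E_flux_def jump_average_periodic)
  finally show ?thesis
    by (simp add: E_flux_def left_diff_distrib sum_subtractf sum_distrib_left mult.assoc)
qed

text \<open>The field source \<open>h\<close> and the correction \<open>r\<close> are left abstract,
  so that one statement serves every \<open>n\<close>.\<close>

lemma moment_equation_summed:
  assumes t: "t \<in> T" and pwC: "\<And>s. s \<in> T \<Longrightarrow> pwpoly Nx xi (C n s)"
    and pw: "pwpoly Nx xi \<phi>" "pwpoly Nx xi (g_fun vth NH c n)" "pwpoly Nx xi h"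
    and eq: "\<And>j. j \<in> {1..Nx} \<Longrightarrow>
      \<exists>D. ((\<lambda>s. integral (cell xi j) (\<lambda>y. C n s y * \<phi> y)) has_real_derivative D) (at t within T) \<and>
        D + a_form vth NH Nx xi c n j \<phi> - b * integral (cell xi j) (\<lambda>y. h y * \<phi> y) = r j"
  shows "((\<lambda>s. integral {0..L} (\<lambda>y. C n s y * \<phi> y)) has_real_derivative
      integral {0..L} (\<lambda>y. g_fun vth NH c n y * deriv \<phi> y)
      + (\<Sum>j=1..Nx. g_flux vth NH Nx xi c n j * jump Nx xi \<phi> j)
      + b * integral {0..L} (\<lambda>y. h y * \<phi> y) + (\<Sum>j=1..Nx. r j)) (at t within T)"
proof -
  \<comment> \<open>The derivative is only known to exist on each cell; choice turns it into a
    function of \<open>j\<close> that can be summed.\<close>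
  obtain D where
    D: "\<And>j. j \<in> {1..Nx} \<Longrightarrow>
      ((\<lambda>s. integral (cell xi j) (\<lambda>y. C n s y * \<phi> y)) has_real_derivative D j) (at t within T)"
    and D_eq: "\<And>j. j \<in> {1..Nx} \<Longrightarrow>
      D j + a_form vth NH Nx xi c n j \<phi> - b * integral (cell xi j) (\<lambda>y. h y * \<phi> y) = r j"
    using bchoice[of "{1..Nx}" "\<lambda>j D.
        ((\<lambda>s. integral (cell xi j) (\<lambda>y. C n s y * \<phi> y)) has_real_derivative D) (at t within T) \<and>
        D + a_form vth NH Nx xi c n j \<phi> - b * integral (cell xi j) (\<lambda>y. h y * \<phi> y) = r j"] eq
    by blast
  have a: "(\<Sum>j=1..Nx. a_form vth NH Nx xi c n j \<phi>)
      = - integral {0..L} (\<lambda>y. g_fun vth NH c n y * deriv \<phi> y)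
        - (\<Sum>j=1..Nx. g_flux vth NH Nx xi c n j * jump Nx xi \<phi> j)"
  proof -
    have "(\<Sum>j=1..Nx. a_form vth NH Nx xi c n j \<phi>)
      = (\<Sum>j=1..Nx. - integral (cell xi j) (\<lambda>y. g_fun vth NH c n y * deriv \<phi> y)
        + (g_flux vth NH Nx xi c n j * left_trace Nx xi \<phi> j
           - g_flux vth NH Nx xi c n (j - 1) * right_trace Nx xi \<phi> (j - 1)))"
      by (simp add: a_form_def algebra_simps)
    then show ?thesis
      by (simp only: sum.distrib sum_flux_trace[of "g_flux vth NH Nx xi c n", OF g_flux_periodic])
        (simp add: sum_negf integral_eq_sum_cells pwpoly_intros pw)
  qed
  have "(\<Sum>j=1..Nx. D j) = (\<Sum>j=1..Nx. r j - a_form vth NH Nx xi c n j \<phi>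
      + b * integral (cell xi j) (\<lambda>y. h y * \<phi> y))"
    by (rule sum.cong) (simp_all flip: D_eq)
  also have "\<dots> = integral {0..L} (\<lambda>y. g_fun vth NH c n y * deriv \<phi> y)
      + (\<Sum>j=1..Nx. g_flux vth NH Nx xi c n j * jump Nx xi \<phi> j)
      + b * integral {0..L} (\<lambda>y. h y * \<phi> y) + (\<Sum>j=1..Nx. r j)"
    unfolding integral_eq_sum_cells[OF pwpoly_mult[OF pw(3,1)]]
    by (simp only: sum.distrib sum_subtractf a sum_distrib_left)
  finally have sum: "(\<Sum>j=1..Nx. D j) = \<dots>" .
  have "((\<lambda>s. \<Sum>j=1..Nx. integral (cell xi j) (\<lambda>y. C n s y * \<phi> y)) has_real_derivative
      (\<Sum>j=1..Nx. D j)) (at t within T)"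
    by (rule DERIV_sum) (rule D)
  \<comment> \<open>The global integral is split into cell integrals only at times in
    \<open>T\<close>, so the derivative is transferred within \<open>T\<close>.\<close>
  then show ?thesis
    unfolding sum
    by (rule has_field_derivative_transform_within[OF _ zero_less_one t])
      (simp add: integral_eq_sum_cells pwpoly_mult pwC pw)
qed

text \<open>Both cells adjacent to an interface contribute the same term, which undoes the factor
  1/2 in the correction.\<close>

lemma sum_r_form_1:
  "(\<Sum>j=1..Nx. r_form vth \<beta> NH Nx xi c e f 1 j (\<lambda>y. 1))
    = - (\<beta> / vth\<^sup>2) * (\<Sum>j=1..Nx. jump Nx xi f j * jump Nx xi e j)"
proof -
  let ?F = "\<lambda>j. jump Nx xi f j * jump Nx xi e j"
  have "(\<Sum>j=1..Nx. r_form vth \<beta> NH Nx xi c e f 1 j (\<lambda>y. 1))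
      = (\<Sum>j=1..Nx. - (\<beta> / (2 * vth\<^sup>2)) * (?F (j - 1) + ?F j))"
    by (rule sum.cong[OF refl]) (simp only: r_form_def trace_one simp_thms if_True mult_1_right)
  also have "\<dots> = 2 * - (\<beta> / (2 * vth\<^sup>2)) * (\<Sum>j=1..Nx. ?F j)"
    by (rule sum_periodic_neighbours) (simp add: jump_average_periodic)
  finally show ?thesis by simp
qed

lemma sum_r_form_2:
  "(\<Sum>j=1..Nx. r_form vth \<beta> NH Nx xi c e f 2 j (\<lambda>y. 1))
    = sqrt 2 / vth * (\<Sum>j=1..Nx. (average Nx xi (c 1) j - C1_flux vth NH Nx xi c j) * jump Nx xi f j)"
proof -
  let ?F = "\<lambda>j. (average Nx xi (c 1) j - C1_flux vth NH Nx xi c j) * jump Nx xi f j"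
  have "(\<Sum>j=1..Nx. r_form vth \<beta> NH Nx xi c e f 2 j (\<lambda>y. 1))
      = (\<Sum>j=1..Nx. 1 / (sqrt 2 * vth) * (?F (j - 1) + ?F j))"
    by (rule sum.cong[OF refl]) (simp add: r_form_def trace_one trace_one[simplified])
  also have "\<dots> = 2 * (1 / (sqrt 2 * vth)) * (\<Sum>j=1..Nx. ?F j)"
    by (rule sum_periodic_neighbours) (simp add: jump_average_periodic C1_flux_def g_flux_periodic)
  also have "\<dots> = sqrt 2 / vth * (\<Sum>j=1..Nx. ?F j)"
    using real_sqrt_mult_self[of 2] by (cases "vth = 0") (simp_all add: field_simps)
  finally show ?thesis .
qed

end

section \<open>Conservation of mass, momentum and energy\<close>

theorem proposition3p1:
  fixes L vth rho0 \<beta> :: real and k Nx NH :: nat and xi :: "nat \<Rightarrow> real" and T :: "real set"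
    and C :: "nat \<Rightarrow> real \<Rightarrow> real \<Rightarrow> real" and E \<Phi> :: "real \<Rightarrow> real \<Rightarrow> real"
  assumes "L > 0" and "vth > 0" and "\<beta> > 0" and "NH \<ge> 3"
    and "mesh L Nx xi"
    and "is_interval T" and "interior T \<noteq> {}"
    and "\<And>n. n < NH \<Longrightarrow> C1_Vh L Nx xi k T (C n)"
    and "C1_Vh L Nx xi k T E"
    and "C1_Vh L Nx xi k T \<Phi>"
    and "\<And>t n j \<phi>. t \<in> T \<Longrightarrow> n < NH \<Longrightarrow> j \<in> {1..Nx} \<Longrightarrow> \<phi> \<in> Vh Nx xi k \<Longrightarrow>
      \<exists>D. ((\<lambda>s. integral (cell xi j) (\<lambda>y. C n s y * \<phi> y)) has_real_derivative D) (at t within T) \<and>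
        D + a_form vth NH Nx xi (\<lambda>m. C m t) n j \<phi>
          - sqrt (real n) / vth *
            integral (cell xi j) (\<lambda>y. E t y * coeff_ext NH (\<lambda>m. C m t) (int n - 1) y * \<phi> y)
        = r_form vth \<beta> NH Nx xi (\<lambda>m. C m t) (E t) (\<Phi> t) n j \<phi>"
    and "\<And>t j \<eta>. t \<in> T \<Longrightarrow> j \<in> {1..Nx} \<Longrightarrow> \<eta> \<in> Vh Nx xi k \<Longrightarrow>
      integral (cell xi j) (\<lambda>y. \<Phi> t y * deriv \<eta> y)
        - Phi_flux Nx xi (\<Phi> t) j * left_trace Nx xi \<eta> j
        + Phi_flux Nx xi (\<Phi> t) (j - 1) * right_trace Nx xi \<eta> (j - 1)
      = integral (cell xi j) (\<lambda>y. E t y * \<eta> y)"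
    and "\<And>t j \<zeta>. t \<in> T \<Longrightarrow> j \<in> {1..Nx} \<Longrightarrow> \<zeta> \<in> Vh Nx xi k \<Longrightarrow>
      - integral (cell xi j) (\<lambda>y. E t y * deriv \<zeta> y)
        + E_flux \<beta> Nx xi (E t) (\<Phi> t) j * left_trace Nx xi \<zeta> j
        - E_flux \<beta> Nx xi (E t) (\<Phi> t) (j - 1) * right_trace Nx xi \<zeta> (j - 1)
      = integral (cell xi j) (\<lambda>y. (vth * C 0 t y - rho0) * \<zeta> y)"
  shows "(\<forall>l\<in>{0, 1 :: nat}. \<forall>t\<in>T. \<exists>D.
            ((\<lambda>s. integral {0..L} (C l s)) has_real_derivative D) (at t within T) \<and>
            vth ^ (l + 1) * D = 0) \<and>
         (\<exists>e0. \<forall>t\<in>T. total_energy L vth \<beta> Nx xi (\<lambda>m. C m t) (E t) (\<Phi> t) = e0)"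
proof -
  interpret periodic_mesh L Nx xi by unfold_locales (rule assms(5))
  note moment = assms(11) and gradient = assms(12) and divergence = assms(13)
  have Vh: "E t \<in> Vh Nx xi k" "\<Phi> t \<in> Vh Nx xi k" "n < NH \<Longrightarrow> C n t \<in> Vh Nx xi k"
    if "t \<in> T" for t n
    using assms(8-10) that unfolding C1_Vh_def by blast+
  note pw = Vh[THEN pwpoly_Vh]
  have pw_ext: "pwpoly Nx xi (coeff_ext NH (\<lambda>m. C m t) i)" if "t \<in> T" for t i
    using pw(3)[OF that] by (auto simp: coeff_ext_def pwpoly_const)
  have pw_g: "pwpoly Nx xi (g_fun vth NH (\<lambda>m. C m t) n)" if "t \<in> T" for t n
    unfolding g_fun_def[abs_def] by (intro pwpoly_intros pw_ext that)
  \<comment> \<open>\<open>NH \<ge> 3\<close> places 0 and 1 inside the index range, so the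
    extension by zero is not reached.\<close>
  have ext: "coeff_ext NH c 0 = c 0" "coeff_ext NH c 1 = c 1" for c
    using \<open>NH \<ge> 3\<close> by (simp_all add: coeff_ext_def)
  have g0: "g_fun vth NH c 0 = (\<lambda>y. vth * c 1 y)" for c
    by (simp add: fun_eq_iff g_fun_def ext)

  have grad: "integral {0..L} (\<lambda>y. E t y * v y)
      = - integral {0..L} (\<lambda>y. deriv (\<Phi> t) y * v y)
        - (\<Sum>j=1..Nx. jump Nx xi (\<Phi> t) j * average Nx xi v j)"
    if "t \<in> T" "v \<in> Vh Nx xi k" for t v
    using that by (intro gradient_equation_summed pw gradient) (auto intro: pwpoly_Vh)
  have div: "integral {0..L} (\<lambda>y. (vth * C 0 t y - rho0) * z y)
      = - integral {0..L} (\<lambda>y. E t y * deriv z y)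
        - (\<Sum>j=1..Nx. average Nx xi (E t) j * jump Nx xi z j)
        + \<beta> * (\<Sum>j=1..Nx. jump Nx xi (\<Phi> t) j * jump Nx xi z j)"
    if "t \<in> T" "z \<in> Vh Nx xi k" for t z
    using that \<open>NH \<ge> 3\<close>
    by (intro divergence_equation_summed pwpoly_diff pwpoly_cmult pwpoly_const pw divergence)
      (auto intro: pwpoly_Vh)
  have mom: "((\<lambda>s. integral {0..L} (\<lambda>y. C n s y * \<phi> y)) has_real_derivative
      integral {0..L} (\<lambda>y. g_fun vth NH (\<lambda>m. C m t) n y * deriv \<phi> y)
      + (\<Sum>j=1..Nx. g_flux vth NH Nx xi (\<lambda>m. C m t) n j * jump Nx xi \<phi> j)
      + sqrt (real n) / vth *
        integral {0..L} (\<lambda>y. E t y * coeff_ext NH (\<lambda>m. C m t) (int n - 1) y * \<phi> y)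
      + (\<Sum>j=1..Nx. r_form vth \<beta> NH Nx xi (\<lambda>m. C m t) (E t) (\<Phi> t) n j \<phi>)) (at t within T)"
    if "t \<in> T" "n < NH" "\<phi> \<in> Vh Nx xi k" for t n \<phi>
    using that by (intro moment_equation_summed pw pw_g pwpoly_mult pw_ext moment)
      (auto intro: pwpoly_Vh)
  \<comment> \<open>A constant test function has zero derivative and zero jumps, so all transport
    terms vanish.\<close>
  have mom_one: "((\<lambda>s. integral {0..L} (C n s)) has_real_derivative
      sqrt (real n) / vth * integral {0..L} (\<lambda>y. E t y * coeff_ext NH (\<lambda>m. C m t) (int n - 1) y)
      + (\<Sum>j=1..Nx. r_form vth \<beta> NH Nx xi (\<lambda>m. C m t) (E t) (\<Phi> t) n j (\<lambda>y. 1))) (at t within T)"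
    if "t \<in> T" "n < NH" for t n
    using mom[OF that const_in_Vh[where c = 1]] by (simp add: jump_one)

  have mass: "((\<lambda>s. integral {0..L} (C 0 s)) has_real_derivative 0) (at t within T)" if "t \<in> T" for t
    using mom_one[OF that, of 0] \<open>NH \<ge> 3\<close> by (simp add: r_form_def)

  \<comment> \<open>What remains is the integral of E times \<open>C 0\<close>, divided by
    \<open>vth\<close>, and the jump correction; the Poisson problem shows that they cancel.\<close>
  have momentum: "((\<lambda>s. integral {0..L} (C 1 s)) has_real_derivative 0) (at t within T)"
    if t: "t \<in> T" for t
  proof -
    let ?S = "\<Sum>j=1..Nx. jump Nx xi (\<Phi> t) j * jump Nx xi (E t) j"
    \<comment> \<open>The first Poisson equation is tested with 1 and its fluxes telescope. The zero
      mean removes \<open>rho0\<close> below.\<close>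
    have E_mean: "integral {0..L} (E t) = 0"
    proof -
      have "integral {0..L} (\<lambda>y. E t y * 1) = (\<Sum>j=1..Nx. integral (cell xi j) (\<lambda>y. E t y * 1))"
        by (intro integral_eq_sum_cells pwpoly_mult pwpoly_const pw t)
      also have "\<dots> = - (\<Sum>j=1..Nx. Phi_flux Nx xi (\<Phi> t) j * left_trace Nx xi (\<lambda>y. 1) j
          - Phi_flux Nx xi (\<Phi> t) (j - 1) * right_trace Nx xi (\<lambda>y. 1) (j - 1))"
        unfolding sum_negf[symmetric]
      proof (rule sum.cong[OF refl])
        fix j assume "j \<in> {1..Nx}"
        from gradient[OF t this const_in_Vh[of 1]]
        show "integral (cell xi j) (\<lambda>y. E t y * 1)
            = - (Phi_flux Nx xi (\<Phi> t) j * left_trace Nx xi (\<lambda>y. 1) j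
                 - Phi_flux Nx xi (\<Phi> t) (j - 1) * right_trace Nx xi (\<lambda>y. 1) (j - 1))"
          by simp
      qed
      also have "\<dots> = 0"
        by (subst sum_flux_trace) (simp_all add: jump_one Phi_flux_def jump_average_periodic)
      finally show ?thesis by simp
    qed
    \<comment> \<open>With both factors equal to E the volume term reduces to traces, which cancel
      the average part of the E flux and leave only the penalty.\<close>
    have parts: "2 * integral {0..L} (\<lambda>y. E t y * deriv (E t) y)
        = - 2 * (\<Sum>j=1..Nx. average Nx xi (E t) j * jump Nx xi (E t) j)"
      using integral_by_parts[OF pw(1)[OF t] pw(1)[OF t]]
      by (simp add: mult.commute flip: sum_distrib_left)
    have "integral {0..L} (\<lambda>y. (vth * C 0 t y - rho0) * E t y) = \<beta> * ?S"
      using div[OF t Vh(1)[OF t]] parts by simp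
    moreover have "integral {0..L} (\<lambda>y. (vth * C 0 t y - rho0) * E t y)
        = vth * integral {0..L} (\<lambda>y. E t y * C 0 t y)"
    proof -
      have "integral {0..L} (\<lambda>y. (vth * C 0 t y - rho0) * E t y)
          = integral {0..L} (\<lambda>y. vth * (E t y * C 0 t y) - rho0 * E t y)"
        by (simp add: algebra_simps)
      also have "\<dots> = integral {0..L} (\<lambda>y. vth * (E t y * C 0 t y)) - integral {0..L} (\<lambda>y. rho0 * E t y)"
        using \<open>NH \<ge> 3\<close> by (intro integral_diff pwpoly_integrable pwpoly_cmult pwpoly_mult pw t) auto
      finally show ?thesis by (simp add: E_mean)
    qed
    ultimately have "integral {0..L} (\<lambda>y. E t y * C 0 t y) = \<beta> * ?S / vth"
      using \<open>vth > 0\<close> by (simp add: field_simps)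
    then show ?thesis
      using mom_one[OF t, of 1] \<open>NH \<ge> 3\<close>
      by (simp add: ext sum_r_form_1[simplified] power2_eq_square)
  qed

  \<comment> \<open>\<open>Q t t\<close> is twice the field energy; separate time arguments allow
    one to vary while the other is frozen.\<close>
  define Q where "Q s r = integral {0..L} (\<lambda>y. E r y * E s y)
      + \<beta> * (\<Sum>j=1..Nx. jump Nx xi (\<Phi> s) j * jump Nx xi (\<Phi> r) j)" for s r
  have Q_sym: "Q s r = Q r s" for s r
    by (simp add: Q_def mult.commute)
  \<comment> \<open>The gradient equation at time \<open>r\<close> is tested with E at time
    \<open>s\<close>, and the divergence equation at \<open>s\<close> with \<Phi> at
    \<open>r\<close>; the mixed terms coincide.\<close>
  have Q_eq: "Q s r = integral {0..L} (\<lambda>y. (vth * C 0 s y - rho0) * \<Phi> r y)"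
    if "s \<in> T" "r \<in> T" for s r
    unfolding Q_def
    using grad[OF that(2) Vh(1)[OF that(1)]] div[OF that(1) Vh(2)[OF that(2)]]
    by (simp add: mult.commute)

  have energy: "total_energy L vth \<beta> Nx xi (\<lambda>m. C m t) (E t) (\<Phi> t)
      = vth ^ 3 * (sqrt 2 * integral {0..L} (C 2 t) + integral {0..L} (C 0 t)) / 2 + Q t t / 2"
    if t: "t \<in> T" for t
  proof -
    have "integral {0..L} (\<lambda>y. vth ^ 3 * (sqrt 2 * C 2 t y + C 0 t y) + \<bar>E t y\<bar>\<^sup>2)
        = integral {0..L} (\<lambda>y. vth ^ 3 * (sqrt 2 * C 2 t y + C 0 t y)) + integral {0..L} (\<lambda>y. (E t y)\<^sup>2)"
      unfolding power2_abs using \<open>NH \<ge> 3\<close>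
      by (intro integral_add pwpoly_integrable pwpoly_intros pw t) auto
    also have "integral {0..L} (\<lambda>y. vth ^ 3 * (sqrt 2 * C 2 t y + C 0 t y))
        = vth ^ 3 * (integral {0..L} (\<lambda>y. sqrt 2 * C 2 t y) + integral {0..L} (C 0 t))"
      unfolding integral_mult_right using \<open>NH \<ge> 3\<close>
      by (subst integral_add) (auto intro!: pwpoly_integrable pwpoly_cmult pw t)
    \<comment> \<open>The total energy samples the jumps at node \<open>j - 1\<close> and
      \<open>Q\<close> at node \<open>j\<close>; periodicity identifies the two sums.\<close>
    finally show ?thesis
      using sum_periodic_shift[of "\<lambda>j. (jump Nx xi (\<Phi> t) j)\<^sup>2" Nx]
      by (simp add: total_energy_def Q_def jump_average_periodic power2_eq_square field_simps)
  qed

  have energy_deriv: "((\<lambda>s. total_energy L vth \<beta> Nx xi (\<lambda>m. C m s) (E s) (\<Phi> s))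
      has_real_derivative 0) (at t within T)" if t: "t \<in> T" for t
  proof -
    \<comment> \<open>\<open>P\<close> is the volume term, \<open>F\<close> the numerical flux term
      and \<open>A\<close> the average term, each pairing \<open>C 1\<close> or its flux with the
      potential.\<close>
    define P where "P = integral {0..L} (\<lambda>y. deriv (\<Phi> t) y * C 1 t y)"
    define F where "F = (\<Sum>j=1..Nx. g_flux vth NH Nx xi (\<lambda>m. C m t) 0 j * jump Nx xi (\<Phi> t) j)"
    define A where "A = (\<Sum>j=1..Nx. jump Nx xi (\<Phi> t) j * average Nx xi (C 1 t) j)"
    have "((\<lambda>s. integral {0..L} (\<lambda>y. C 0 s y * \<Phi> t y)) has_real_derivative vth * P + F) (at t within T)"
      using mom[OF t _ Vh(2)[OF t], of 0] \<open>NH \<ge> 3\<close>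
      by (simp add: r_form_def g0 P_def F_def mult.assoc mult.commute[of "deriv (\<Phi> t) _"])
    then have dQ: "((\<lambda>s. Q s s) has_real_derivative 2 * vth * (vth * P + F)) (at t within T)"
      using symmetric_form_has_derivative[of k T "C 0" \<Phi> t Q, OF _ assms(10) t Q_sym Q_eq]
        assms(8)[of 0] \<open>NH \<ge> 3\<close> by simp
    have "integral {0..L} (\<lambda>y. E t y * C 1 t y) = - P - A"
      using grad[OF t Vh(3)[OF t, of 1]] \<open>NH \<ge> 3\<close> by (simp add: P_def A_def)
    \<comment> \<open>The correction for \<open>C 2\<close> exchanges the average of
      \<open>C 1\<close> for its numerical flux: \<open>A\<close> cancels the average term from the
      field source, and \<open>F / vth\<close> takes its place.\<close>
    moreover have "(\<Sum>j=1..Nx. (average Nx xi (C 1 t) j - C1_flux vth NH Nx xi (\<lambda>m. C m t) j)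
        * jump Nx xi (\<Phi> t) j) = A - F / vth"
      by (simp add: A_def F_def C1_flux_def left_diff_distrib right_diff_distrib sum_subtractf sum_divide_distrib mult.commute)
    ultimately have dC2: "((\<lambda>s. integral {0..L} (C 2 s)) has_real_derivative
        sqrt 2 / vth * (- P - A) + sqrt 2 / vth * (A - F / vth)) (at t within T)"
      using mom_one[OF t, of 2] \<open>NH \<ge> 3\<close> by (simp add: ext sum_r_form_2[simplified])
    have "((\<lambda>s. vth ^ 3 * (sqrt 2 * integral {0..L} (C 2 s) + integral {0..L} (C 0 s)) / 2 + Q s s / 2)
        has_real_derivative
        vth ^ 3 * (sqrt 2 * (sqrt 2 / vth * (- P - A) + sqrt 2 / vth * (A - F / vth)) + 0) / 2
        + 2 * vth * (vth * P + F) / 2) (at t within T)"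
      by (intro DERIV_add DERIV_cdivide DERIV_cmult dC2 dQ mass t)
    \<comment> \<open>Since \<open>sqrt 2 * sqrt 2 = 2\<close>, the kinetic part is minus
      \<open>vth\<^sup>2 * P + vth * F\<close>, the opposite of the field part.\<close>
    moreover have "vth ^ 3 * (sqrt 2 * (sqrt 2 / vth * (- P - A) + sqrt 2 / vth * (A - F / vth)) + 0) / 2
        + 2 * vth * (vth * P + F) / 2 = 0"
    proof -
      have "sqrt 2 * (sqrt 2 / vth * (- P - A) + sqrt 2 / vth * (A - F / vth))
          = sqrt 2 * sqrt 2 * ((- P - F / vth) / vth)"
        by (simp add: algebra_simps diff_divide_distrib add_divide_distrib)
      then show ?thesis
        using \<open>vth > 0\<close> by (simp add: power3_eq_cube field_simps)
    qed
    ultimately have "((\<lambda>s. vth ^ 3 * (sqrt 2 * integral {0..L} (C 2 s) + integral {0..L} (C 0 s)) / 2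
        + Q s s / 2) has_real_derivative 0) (at t within T)"
      by (simp only:)
    then show ?thesis
      by (rule has_field_derivative_transform_within[OF _ zero_less_one t]) (simp only: energy)
  qed
  have "\<exists>e0. \<forall>t\<in>T. total_energy L vth \<beta> Nx xi (\<lambda>m. C m t) (E t) (\<Phi> t) = e0"
    using energy_deriv \<open>is_interval T\<close>
    by (intro has_field_derivative_zero_constant) (auto simp: is_interval_convex_1)
  then show ?thesis
    using mass momentum by fastforce
qed

end
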